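(* Assume (A1). Then the multivalued operator $A_{\rho,h}$ is monotone: for any two discrete triplets $w=(m,u,\varpi)$ and $\tilde w=(\tilde m,\tilde u,\tilde\varpi)$ with $m,\tilde m\ge0$, $m_{i,0}=\tilde m_{i,0}=\bar m_i$ and $u_{i,N}=\tilde u_{i,N}=\bar u_i$ for all $i\in\mathbb{Z}$, and for any elements $a\in A_{\rho,h}[w]$ and $\tilde a\in A_{\rho,h}[\tilde w]$ (i.e. for any choice of $\mu^*\in\mathcal{M}[u]$ and $\tilde\mu^*\in\mathcal{M}[\tilde u]$), $$\langle \tilde a-a,\ \tilde w-w\rangle\ \ge 0 .$$
   Context: (A1): $l_0\in C^2(\mathbb{R})$ with $l_0''\ge\kappa>0$ and $V:\mathbb{R}\to\mathbb{R}$ is bounded from below. Grid: $\rho,h>0$, $N\in\mathbb{N}$ with $Nh=T$; $x_i=i\rho$, $t_k=kh$; $\beta_i(x)=\max\{1-|x-x_i|/\rho,0\}$; $I[f](x)=\sum_{i\in\mathbb{Z}}f_i\beta_i(x)$ for $f=(f_i)_{i\in\mathbb{Z}}$; $y_i(\alpha)=x_i+h\alpha$. Given numbers: $Q_k$ ($0\le k\le N-1$), and $\bar m_i,\bar u_i$ ($i\in\mathbb{Z}$). A discrete triplet is $w=(m,u,\varpi)$ with $m=(m_{i,k})$, $u=(u_{i,k})$ ($i\in\mathbb{Z}$, $0\le k\le N$) and $\varpi=(\varpi_k)_{0\le k\le N-1}$ real, where $m$ is finitely supported and $i\mapsto u_{i,k}$ is Lipschitz on the grid for each $k$. Put $L_{i,k}(\alpha)=l_0(\alpha)+V(x_i)+\varpi_k\alpha$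 and let $\Lambda_{i,k}$ be the set of minimizers over $\alpha\in\mathbb{R}$ of $I[u_{k+1}](y_i(\alpha))+hL_{i,k}(\alpha)$, where $u_{k+1}=(u_{i,k+1})_{i}$. $\mathcal{M}[u]$ is the set of families $\mu^*=(\mu^*_{i,k})_{i\in\mathbb{Z},0\le k\le N-1}$ of Borel probability measures with $\mu^*_{i,k}$ supported on $\Lambda_{i,k}$ (these sets are determined by $u$ and the price $\varpi$ of the triplet). $A_{\rho,h}[w]$ is the set of all triples $(a^1_{i,k},a^2_{i,k},a^3_k)_{i\in\mathbb{Z},0\le k\le N-1}$, $\mu^*\in\mathcal{M}[u]$, with $a^1_{i,k}=-u_{i,k}+I[u_{k+1}](y_i(\alpha^*_{i,k}))+hL_{i,k}(\alpha^*_{i,k})$ (for any $\alpha^*_{i,k}\in\Lambda_{i,k}$; the value does not depend on the choice), $a^2_{i,k}=m_{i,k+1}-\sum_{n\in\mathbb{Z}}m_{n,k}\int\beta_i(y_n(\alpha))\,d\mu^*_{n,k}(\alpha)$, $a^3_k=-h\big(\rho\sum_{i\in\mathbb{Z}}m_{i,k}\int\alpha\,d\mu^*_{i,k}(\alpha)-Q_k\big)$. Pairing of $a=(a^1,a^2,a^3)$ with a triplet $w=(m,u,\varpi)$ (also used for differences of triplets): $$\langle a,w\rangle=h\sum_{k=0}^{N-1}\Big[\rho\sum_{i\in\mathbb{Z}}\big(a^1_{i,k}m_{i,k}+a^2_{i,k}u_{i,k+1}\big)+a^3_k\varpi_k\Big].$$ *)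

theory Defs
  imports "HOL-Probability.Probability"
begin

definition assumption_A1 :: "(real \<Rightarrow> real) \<Rightarrow> (real \<Rightarrow> real) \<Rightarrow> bool" where
  "assumption_A1 l\<^sub>0 V \<longleftrightarrow>
     (\<exists>\<kappa>>0. \<exists>l\<^sub>0' l\<^sub>0''.
        (\<forall>x. (l\<^sub>0 has_real_derivative l\<^sub>0' x) (at x)) \<and>
        (\<forall>x. (l\<^sub>0' has_real_derivative l\<^sub>0'' x) (at x)) \<and>
        continuous_on UNIV l\<^sub>0'' \<and>
        (\<forall>x. \<kappa> \<le> l\<^sub>0'' x)) \<and>
     bdd_below (range V)"

definition grid_point :: "real \<Rightarrow> int \<Rightarrow> real" where
  "grid_point \<rho> i = of_int i * \<rho>"

definition hat :: "real \<Rightarrow> int \<Rightarrow> real \<Rightarrow> real" where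
  "hat \<rho> i x = max (1 - \<bar>x - grid_point \<rho> i\<bar> / \<rho>) 0"

text \<open>At every point at most two hat functions are nonzero, so the sum over the integers below has
  only finitely many nonzero terms.\<close>
definition interp :: "real \<Rightarrow> (int \<Rightarrow> real) \<Rightarrow> real \<Rightarrow> real" where
  "interp \<rho> f x = (\<Sum>\<^sub>\<infinity>i\<in>UNIV. f i * hat \<rho> i x)"

definition arrival :: "real \<Rightarrow> real \<Rightarrow> int \<Rightarrow> real \<Rightarrow> real" where
  "arrival \<rho> h i \<alpha> = grid_point \<rho> i + h * \<alpha>"

text \<open>A triplet \<open>(m, u, p)\<close> consists of the mass, the value function and the price, with arguments in
  the order \<open>m i k\<close>, \<open>u i k\<close>, \<open>p k\<close>. The time index is a
  natural number; \<open>m\<close> and \<open>u\<close> are relevant only for \<open>k \<le> N\<close>, and \<open>p\<close> and all components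
  of operator values only for \<open>k < N\<close>. Values at other times are never constrained or used.
  Differences of triplets are taken with the componentwise and pointwise subtraction of the library.\<close>
type_synonym triplet =
  "(int \<Rightarrow> nat \<Rightarrow> real) \<times> (int \<Rightarrow> nat \<Rightarrow> real) \<times> (nat \<Rightarrow> real)"

definition discrete_triplet :: "real \<Rightarrow> nat \<Rightarrow> triplet \<Rightarrow> bool" where
  "discrete_triplet \<rho> N = (\<lambda>(m, u, p).
     finite {(i, k). k \<le> N \<and> m i k \<noteq> 0} \<and>
     (\<forall>k\<le>N. \<exists>C. \<forall>i j. \<bar>u i k - u j k\<bar> \<le> C * \<bar>grid_point \<rho> i - grid_point \<rho> j\<bar>))"

definition running_cost ::
  "(real \<Rightarrow> real) \<Rightarrow> (real \<Rightarrow> real) \<Rightarrow> real \<Rightarrow> (nat \<Rightarrow> real) \<Rightarrow> int \<Rightarrow> nat \<Rightarrow> real \<Rightarrow> real" where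
  "running_cost l\<^sub>0 V \<rho> p i k \<alpha> = l\<^sub>0 \<alpha> + V (grid_point \<rho> i) + p k * \<alpha>"

definition step_cost ::
  "(real \<Rightarrow> real) \<Rightarrow> (real \<Rightarrow> real) \<Rightarrow> real \<Rightarrow> real \<Rightarrow> (int \<Rightarrow> nat \<Rightarrow> real) \<Rightarrow> (nat \<Rightarrow> real)
     \<Rightarrow> int \<Rightarrow> nat \<Rightarrow> real \<Rightarrow> real" where
  "step_cost l\<^sub>0 V \<rho> h u p i k \<alpha> =
     interp \<rho> (\<lambda>j. u j (k + 1)) (arrival \<rho> h i \<alpha>) + h * running_cost l\<^sub>0 V \<rho> p i k \<alpha>"

definition minimizers ::
  "(real \<Rightarrow> real) \<Rightarrow> (real \<Rightarrow> real) \<Rightarrow> real \<Rightarrow> real \<Rightarrow> (int \<Rightarrow> nat \<Rightarrow> real) \<Rightarrow> (nat \<Rightarrow> real)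
     \<Rightarrow> int \<Rightarrow> nat \<Rightarrow> real set" where
  "minimizers l\<^sub>0 V \<rho> h u p i k =
     {\<alpha>. is_arg_min (step_cost l\<^sub>0 V \<rho> h u p i k) (\<lambda>_. True) \<alpha>}"

definition optimal_measures ::
  "(real \<Rightarrow> real) \<Rightarrow> (real \<Rightarrow> real) \<Rightarrow> real \<Rightarrow> real \<Rightarrow> nat \<Rightarrow> (int \<Rightarrow> nat \<Rightarrow> real) \<Rightarrow> (nat \<Rightarrow> real)
     \<Rightarrow> (int \<Rightarrow> nat \<Rightarrow> real measure) set" where
  "optimal_measures l\<^sub>0 V \<rho> h N u p =
     {\<mu>. \<forall>i. \<forall>k<N. prob_space (\<mu> i k) \<and> sets (\<mu> i k) = sets borel \<and>
           (AE \<alpha> in \<mu> i k. \<alpha> \<in> minimizers l\<^sub>0 V \<rho> h u p i k)}"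

text \<open>All minimizers give the same value of \<open>step_cost\<close>, so the existential quantifier over \<open>\<alpha>\<close> in
  the first component determines \<open>a\<^sub>1 i k\<close>.\<close>
definition disc_operator ::
  "(real \<Rightarrow> real) \<Rightarrow> (real \<Rightarrow> real) \<Rightarrow> real \<Rightarrow> real \<Rightarrow> nat \<Rightarrow> (nat \<Rightarrow> real) \<Rightarrow> triplet
     \<Rightarrow> triplet set" where
  "disc_operator l\<^sub>0 V \<rho> h N Q = (\<lambda>(m, u, p).
     {(a\<^sub>1, a\<^sub>2, a\<^sub>3). \<exists>\<mu>\<in>optimal_measures l\<^sub>0 V \<rho> h N u p.
        (\<forall>i. \<forall>k<N. \<exists>\<alpha>\<in>minimizers l\<^sub>0 V \<rho> h u p i k.
           a\<^sub>1 i k = - u i k + interp \<rho> (\<lambda>j. u j (k + 1)) (arrival \<rho> h i \<alpha>)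
                      + h * running_cost l\<^sub>0 V \<rho> p i k \<alpha>) \<and>
        (\<forall>i. \<forall>k<N.
           a\<^sub>2 i k = m i (k + 1)
             - (\<Sum>\<^sub>\<infinity>n\<in>UNIV. m n k * (LINT \<alpha>|\<mu> n k. hat \<rho> i (arrival \<rho> h n \<alpha>)))) \<and>
        (\<forall>k<N.
           a\<^sub>3 k = - h * (\<rho> * (\<Sum>\<^sub>\<infinity>i\<in>UNIV. m i k * (LINT \<alpha>|\<mu> i k. \<alpha>)) - Q k))})"

definition pairing :: "real \<Rightarrow> real \<Rightarrow> nat \<Rightarrow> triplet \<Rightarrow> triplet \<Rightarrow> real" where
  "pairing \<rho> h N = (\<lambda>(a\<^sub>1, a\<^sub>2, a\<^sub>3) (m, u, p).
     h * (\<Sum>k<N. \<rho> * (\<Sum>\<^sub>\<infinity>i\<in>UNIV. a\<^sub>1 i k * m i k + a\<^sub>2 i k * u i (k + 1)) + a\<^sub>3 k * p k))"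

end

theory Submission
  imports Defs
begin

text \<open>
  Fix a time level and a node \<open>n\<close>, and let \<open>c n k\<close> be the minimal value of \<open>step_cost\<close>. For a fixed
  control \<open>\<alpha>\<close> the step cost is affine in \<open>(u, p)\<close>, so the minimal value, an infimum of affine
  functions, is concave in \<open>(u, p)\<close>; averaging the coefficients of \<open>u\<close> and \<open>p\<close> over a measure carried
  by the minimizers gives a supergradient. These averages are \<open>\<integral> hat d\<mu>\<close> and \<open>h * \<integral> \<alpha> d\<mu>\<close>, exactly the
  quantities that transport the mass in the second component of the operator and balance the price
  in the third. Hence pairing the differences produces, besides the terms containing
  \<open>u i k\<close> and \<open>m i (k + 1)\<close> on their own, only the two supergradient gaps (from \<open>(u, p)\<close> to
  \<open>(u', p')\<close> weighted with \<open>m\<close>, and back weighted with \<open>m'\<close>), both nonnegative since the masses are.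
  The remaining terms are the increments in \<open>k\<close> of
  \<open>\<Sum>i. (m' i k - m i k) * (u' i k - u i k)\<close>; summed over \<open>k\<close> they telescope to zero, because the
  initial masses agree and the terminal values agree. The concavity is
  \<open>optimal_value_supergradient\<close> and the rearrangement is \<open>monotonicity_identity\<close>.

  The analytic point is that all averages and sums are finite. Interpolated Lipschitz data grow
  at most linearly whereas \<open>l\<^sub>0\<close> grows quadratically, so minimizers are bounded
  (\<open>minimizers_bounded\<close>). Therefore each of the finitely many nodes carrying mass sends it to finitely
  many nodes, and every series over the grid is a sum over one finite set
  (\<open>disc_operator_finite_form\<close>).
\<close>

section \<open>Interpolation on the grid\<close>

lemma hat_nonneg: "0 \<le> hat \<rho> i x"
  by (simp add: hat_def)

lemma hat_le_1: "0 < \<rho> \<Longrightarrow> hat \<rho> i x \<le> 1"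
  by (simp add: hat_def)

lemma hat_eq_0: "0 < \<rho> \<Longrightarrow> \<rho> \<le> \<bar>x - grid_point \<rho> i\<bar> \<Longrightarrow> hat \<rho> i x = 0"
  by (simp add: hat_def field_simps)

lemma borel_measurable_hat [measurable]: "hat \<rho> i \<in> borel_measurable borel"
  unfolding hat_def by measurable

lemma infsum_eq_sum:
  fixes f :: "'a \<Rightarrow> real"
  assumes "finite F" and "\<And>i. i \<notin> F \<Longrightarrow> f i = 0"
  shows "(\<Sum>\<^sub>\<infinity>i\<in>UNIV. f i) = (\<Sum>i\<in>F. f i)"
proof -
  have "infsum f UNIV = infsum f F"
    by (rule infsum_cong_neutral) (use assms in auto)
  with assms(1) show ?thesis by simp
qed

lemma interp_eq_sum:
  assumes "finite F" and "\<And>i. i \<notin> F \<Longrightarrow> hat \<rho> i x = 0"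
  shows "interp \<rho> f x = (\<Sum>i\<in>F. f i * hat \<rho> i x)"
  unfolding interp_def by (rule infsum_eq_sum) (use assms in auto)

lemma hat_eq_0_outside_cell:
  assumes "0 < \<rho>" and "i \<notin> {\<lfloor>x / \<rho>\<rfloor>, \<lfloor>x / \<rho>\<rfloor> + 1}"
  shows "hat \<rho> i x = 0"
proof -
  have "real_of_int i \<le> x / \<rho> - 1 \<or> x / \<rho> + 1 \<le> real_of_int i"
    using assms(2) by simp linarith
  then have "\<rho> \<le> \<bar>x - grid_point \<rho> i\<bar>"
    using assms(1) by (auto simp: grid_point_def field_simps)
  then show ?thesis by (rule hat_eq_0[OF assms(1)])
qed

text \<open>The constant is crude: the two hat functions that do not vanish at \<open>x\<close> are each bounded by one
  and sit at nodes within distance \<open>\<rho>\<close> of \<open>x\<close>, which accounts for the factor 2 and the \<open>\<rho>\<close>. Only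
  the linear order in \<open>\<bar>x\<bar>\<close> matters, for the comparison with the quadratic growth of \<open>l\<^sub>0\<close>.\<close>
lemma interp_linear_growth:
  assumes \<rho>: "0 < \<rho>"
    and lip: "\<And>i j. \<bar>f i - f j\<bar> \<le> C * \<bar>grid_point \<rho> i - grid_point \<rho> j\<bar>"
  shows "\<bar>interp \<rho> f x\<bar> \<le> 2 * (\<bar>f 0\<bar> + \<bar>C\<bar> * (\<bar>x\<bar> + \<rho>))"
proof -
  define i where "i = \<lfloor>x / \<rho>\<rfloor>"
  have near: "\<bar>f j\<bar> * hat \<rho> j x \<le> \<bar>f 0\<bar> + \<bar>C\<bar> * (\<bar>x\<bar> + \<rho>)" for j
  proof (cases "\<rho> \<le> \<bar>x - grid_point \<rho> j\<bar>")
    case True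
    then show ?thesis using \<rho> by (simp add: hat_eq_0)
  next
    case False
    then have "\<bar>grid_point \<rho> j\<bar> \<le> \<bar>x\<bar> + \<rho>" by linarith
    then have "\<bar>C\<bar> * \<bar>grid_point \<rho> j\<bar> \<le> \<bar>C\<bar> * (\<bar>x\<bar> + \<rho>)"
      by (intro mult_left_mono) auto
    moreover have "C * \<bar>grid_point \<rho> j\<bar> \<le> \<bar>C\<bar> * \<bar>grid_point \<rho> j\<bar>"
      by (intro mult_right_mono) auto
    moreover have "\<bar>f j - f 0\<bar> \<le> C * \<bar>grid_point \<rho> j\<bar>"
      using lip[of j 0] by (simp add: grid_point_def)
    ultimately have "\<bar>f j\<bar> \<le> \<bar>f 0\<bar> + \<bar>C\<bar> * (\<bar>x\<bar> + \<rho>)" by linarith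
    moreover have "\<bar>f j\<bar> * hat \<rho> j x \<le> \<bar>f j\<bar>"
      using hat_le_1[OF \<rho>] by (simp add: mult_left_le)
    ultimately show ?thesis by linarith
  qed
  have "interp \<rho> f x = (\<Sum>j\<in>{i, i + 1}. f j * hat \<rho> j x)"
    by (rule interp_eq_sum) (use \<rho> hat_eq_0_outside_cell in \<open>auto simp: i_def\<close>)
  then have "\<bar>interp \<rho> f x\<bar> \<le> (\<Sum>j\<in>{i, i + 1}. \<bar>f j\<bar> * hat \<rho> j x)"
    using sum_abs[of "\<lambda>j. f j * hat \<rho> j x" "{i, i + 1}"] by (simp add: abs_mult hat_nonneg)
  then show ?thesis using near[of i] near[of "i + 1"] by simp
qed

lemma finite_grid_points:
  assumes "0 < \<rho>" shows "finite {i. \<bar>grid_point \<rho> i - z\<bar> \<le> r}"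
proof (rule finite_subset)
  show "{i. \<bar>grid_point \<rho> i - z\<bar> \<le> r} \<subseteq> {\<lfloor>(z - r) / \<rho>\<rfloor>..\<lceil>(z + r) / \<rho>\<rceil>}"
  proof safe
    fix i assume "\<bar>grid_point \<rho> i - z\<bar> \<le> r"
    then have "(z - r) / \<rho> \<le> i" "i \<le> (z + r) / \<rho>"
      using assms by (auto simp: grid_point_def field_simps abs_le_iff)
    then show "i \<in> {\<lfloor>(z - r) / \<rho>\<rfloor>..\<lceil>(z + r) / \<rho>\<rceil>}" by simp linarith
  qed
qed simp

section \<open>Minimizers stay in a bounded set\<close>

text \<open>Subtracting \<open>\<kappa> / 2 * \<alpha>\<^sup>2\<close> leaves a convex function, which lies above its tangent at 0.\<close>
lemma assumption_A1_quadratic_growth: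
  assumes "assumption_A1 l\<^sub>0 V"
  obtains \<kappa> c where "0 < \<kappa>" and "\<And>\<alpha>. l\<^sub>0 0 + c * \<alpha> + \<kappa> * \<alpha>\<^sup>2 \<le> l\<^sub>0 \<alpha>"
proof -
  obtain \<kappa> l' l'' where \<kappa>: "0 < \<kappa>"
    and l': "\<And>x. (l\<^sub>0 has_real_derivative l' x) (at x)"
    and l'': "\<And>x. (l' has_real_derivative l'' x) (at x)" "\<And>x. \<kappa> \<le> l'' x"
    using assms unfolding assumption_A1_def by blast
  define g where "g \<alpha> = l\<^sub>0 \<alpha> - \<kappa> / 2 * \<alpha>\<^sup>2" for \<alpha>
  have dg: "(g has_real_derivative l' x - \<kappa> * x) (at x)" for x
    unfolding g_def by (auto intro!: derivative_eq_intros l')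
  have "convex_on UNIV g"
    by (rule f''_ge0_imp_convex[where f' = "\<lambda>x. l' x - \<kappa> * x" and f'' = "\<lambda>x. l'' x - \<kappa>"])
       (auto intro!: derivative_eq_intros dg l'')
  then have "l' 0 * \<alpha> \<le> g \<alpha> - g 0" for \<alpha>
    using convex_on_imp_above_tangent[of UNIV g 0 \<alpha> "l' 0"] dg[of 0] by simp
  then have "l\<^sub>0 0 + l' 0 * \<alpha> + \<kappa> / 2 * \<alpha>\<^sup>2 \<le> l\<^sub>0 \<alpha>" for \<alpha>
    by (simp add: g_def algebra_simps)
  with \<kappa> show ?thesis by (intro that[of "\<kappa> / 2" "l' 0"]) auto
qed

lemma quadratic_le_linear_bound:
  fixes t :: real
  assumes "0 < a" "0 \<le> t" "0 \<le> b" "0 \<le> d" "a * t\<^sup>2 \<le> b * t + d"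
  shows "t \<le> (b + d) / a + 1"
proof (rule ccontr)
  assume "\<not> ?thesis"
  then have "(b + d) / a < t - 1" by simp
  moreover have "0 \<le> (b + d) / a" using assms by simp
  ultimately have t: "1 < t" "(b + d) / a < t" by linarith+
  then have bd: "b + d < a * t" using assms(1) by (simp add: field_simps)
  have "a * t\<^sup>2 > (b + d) * t"
    using mult_strict_right_mono[OF bd, of t] t(1) by (simp add: power2_eq_square mult.assoc)
  moreover have "d \<le> d * t" using t(1) assms(4) by (simp add: mult_le_cancel_left1)
  ultimately show False using assms(5) by (simp add: distrib_right)
qed

lemma step_cost_le_minimizer:
  "\<alpha> \<in> minimizers l\<^sub>0 V \<rho> h u p i k
    \<Longrightarrow> step_cost l\<^sub>0 V \<rho> h u p i k \<alpha> \<le> step_cost l\<^sub>0 V \<rho> h u p i k \<beta>"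
  by (auto simp: minimizers_def is_arg_min_def not_less)

text \<open>A minimizer costs at most as much as the control 0. The interpolated value, the price
  and the tangent of \<open>l\<^sub>0\<close> can lower the cost of \<open>\<alpha>\<close> only at a linear rate, at most \<open>b\<close> in total,
  whereas the quadratic part of \<open>l\<^sub>0\<close> raises it by \<open>h * \<kappa> * \<alpha>\<^sup>2\<close>.\<close>
lemma minimizers_bounded:
  assumes A1: "assumption_A1 l\<^sub>0 V" and \<rho>: "0 < \<rho>" and h: "0 < h"
    and lip: "\<And>i j. \<bar>u i (k + 1) - u j (k + 1)\<bar> \<le> C * \<bar>grid_point \<rho> i - grid_point \<rho> j\<bar>"
  shows "\<exists>R. \<forall>\<alpha> \<in> minimizers l\<^sub>0 V \<rho> h u p n k. \<bar>\<alpha>\<bar> \<le> R"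
proof -
  obtain \<kappa> c where \<kappa>: "0 < \<kappa>" and growth: "\<And>\<alpha>. l\<^sub>0 0 + c * \<alpha> + \<kappa> * \<alpha>\<^sup>2 \<le> l\<^sub>0 \<alpha>"
    using assumption_A1_quadratic_growth[OF A1] by metis
  define I where "I \<alpha> = interp \<rho> (\<lambda>j. u j (k + 1)) (arrival \<rho> h n \<alpha>)" for \<alpha>
  define x where "x = \<bar>grid_point \<rho> n\<bar>"
  define B where "B = 2 * (\<bar>u 0 (k + 1)\<bar> + \<bar>C\<bar> * (x + \<rho>))"
  have I: "\<bar>I \<alpha>\<bar> \<le> B + 2 * \<bar>C\<bar> * h * \<bar>\<alpha>\<bar>" for \<alpha>
  proof -
    have "\<bar>arrival \<rho> h n \<alpha>\<bar> \<le> x + h * \<bar>\<alpha>\<bar>"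
      unfolding arrival_def x_def using abs_triangle_ineq[of "grid_point \<rho> n" "h * \<alpha>"] h
      by (simp add: abs_mult)
    then have "\<bar>C\<bar> * \<bar>arrival \<rho> h n \<alpha>\<bar> \<le> \<bar>C\<bar> * (x + h * \<bar>\<alpha>\<bar>)"
      by (intro mult_left_mono) auto
    with interp_linear_growth[OF \<rho> lip, of "arrival \<rho> h n \<alpha>"]
    show ?thesis unfolding I_def B_def by (simp add: algebra_simps)
  qed
  have B: "0 \<le> B" using \<rho> by (auto simp: B_def x_def)
  define b where "b = 2 * \<bar>C\<bar> * h + h * \<bar>c + p k\<bar>"
  have "\<bar>\<alpha>\<bar> \<le> (b + 2 * B) / (h * \<kappa>) + 1" if \<alpha>: "\<alpha> \<in> minimizers l\<^sub>0 V \<rho> h u p n k" for \<alpha>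
  proof (rule quadratic_le_linear_bound)
    have "I \<alpha> + h * (l\<^sub>0 \<alpha> + p k * \<alpha>) \<le> I 0 + h * l\<^sub>0 0"
      using step_cost_le_minimizer[OF \<alpha>, of 0]
      by (simp add: step_cost_def running_cost_def I_def algebra_simps)
    moreover have "h * (l\<^sub>0 0 + c * \<alpha> + \<kappa> * \<alpha>\<^sup>2) \<le> h * l\<^sub>0 \<alpha>"
      using growth h by simp
    moreover have "- (h * ((c + p k) * \<alpha>)) \<le> h * (\<bar>c + p k\<bar> * \<bar>\<alpha>\<bar>)"
      using mult_left_mono[OF abs_ge_minus_self[of "(c + p k) * \<alpha>"], of h] h
      by (simp add: abs_mult)
    ultimately have "h * \<kappa> * \<alpha>\<^sup>2 \<le> (I 0 - I \<alpha>) + h * (\<bar>c + p k\<bar> * \<bar>\<alpha>\<bar>)"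
      unfolding distrib_left distrib_right mult.assoc by linarith
    also have "I 0 - I \<alpha> \<le> 2 * B + 2 * \<bar>C\<bar> * h * \<bar>\<alpha>\<bar>"
      using abs_le_D1[OF I[of 0]] abs_le_D2[OF I[of \<alpha>]] by simp
    finally show "h * \<kappa> * \<bar>\<alpha>\<bar>\<^sup>2 \<le> b * \<bar>\<alpha>\<bar> + 2 * B"
      by (simp add: b_def algebra_simps)
  qed (use h \<kappa> B in \<open>auto simp: b_def\<close>)
  then show ?thesis by blast
qed

section \<open>Concavity of the optimal value\<close>

text \<open>A bounded control moves a node by a bounded distance, so its mass arrives in the supports of
  finitely many hat functions.\<close>
lemma bounded_controls_reach:
  assumes \<rho>: "0 < \<rho>" and h: "0 < h"
    and \<mu>: "prob_space \<mu>" "sets \<mu> = sets borel"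
    and R: "AE \<alpha> in \<mu>. \<bar>\<alpha>\<bar> \<le> R"
  shows "\<exists>F. finite F \<and> (AE \<alpha> in \<mu>. \<forall>j. j \<notin> F \<longrightarrow> hat \<rho> j (arrival \<rho> h n \<alpha>) = 0)"
proof (intro exI conjI)
  show "finite {j. \<bar>grid_point \<rho> j - grid_point \<rho> n\<bar> \<le> \<rho> + h * R}"
    by (rule finite_grid_points[OF \<rho>])
  show "AE \<alpha> in \<mu>. \<forall>j. j \<notin> {j. \<bar>grid_point \<rho> j - grid_point \<rho> n\<bar> \<le> \<rho> + h * R}
          \<longrightarrow> hat \<rho> j (arrival \<rho> h n \<alpha>) = 0"
    using R
  proof eventually_elim
    case (elim \<alpha>)
    then have "\<bar>h * \<alpha>\<bar> \<le> h * R" using h by (simp add: abs_mult)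
    then show ?case by (auto intro!: hat_eq_0[OF \<rho>] simp: arrival_def)
  qed
qed

text \<open>The difference of the two step costs at the same control is affine in \<open>(u' - u, p' - p)\<close>, since
  \<open>l\<^sub>0\<close> and \<open>V\<close> cancel. At a minimizer for \<open>(u, p)\<close> the old cost equals the old optimal value and the
  new cost is at least \<open>c'\<close>; integrating over the minimizers gives the supergradient inequality.
  The bound \<open>R\<close> supplies integrability of \<open>\<alpha>\<close>, and the finite set \<open>F\<close> lets the integral pass
  through the interpolation sum.\<close>
lemma optimal_value_supergradient:
  assumes \<rho>: "0 < \<rho>"
    and \<mu>: "prob_space \<mu>" "sets \<mu> = sets borel"
    and opt: "AE \<alpha> in \<mu>. step_cost l\<^sub>0 V \<rho> h u p n k \<alpha> = c"
    and R: "AE \<alpha> in \<mu>. \<bar>\<alpha>\<bar> \<le> R"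
    and F: "finite F" "AE \<alpha> in \<mu>. \<forall>j. j \<notin> F \<longrightarrow> hat \<rho> j (arrival \<rho> h n \<alpha>) = 0"
    and c': "\<And>\<alpha>. c' \<le> step_cost l\<^sub>0 V \<rho> h u' p' n k \<alpha>"
  shows "c' - c \<le> (\<Sum>j\<in>F. (u' j (k + 1) - u j (k + 1)) * (LINT \<alpha>|\<mu>. hat \<rho> j (arrival \<rho> h n \<alpha>)))
                   + h * (p' k - p k) * (LINT \<alpha>|\<mu>. \<alpha>)"
proof -
  interpret prob_space \<mu> by (rule \<mu>(1))
  note [measurable_cong] = \<mu>(2)
  have [simp]: "integrable \<mu> (\<lambda>\<alpha>. \<alpha>)"
    by (rule integrable_const_bound[where B = R]) (use R in auto)
  have [simp]: "integrable \<mu> (\<lambda>\<alpha>. hat \<rho> j (arrival \<rho> h n \<alpha>))" for j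
    by (rule integrable_const_bound[where B = 1])
       (auto simp: hat_nonneg hat_le_1[OF \<rho>] arrival_def)
  let ?D = "\<lambda>\<alpha>. (\<Sum>j\<in>F. (u' j (k + 1) - u j (k + 1)) * hat \<rho> j (arrival \<rho> h n \<alpha>))
                   + h * (p' k - p k) * \<alpha>"
  have D: "AE \<alpha> in \<mu>. c' - c \<le> ?D \<alpha>"
    using opt F(2)
  proof eventually_elim
    case (elim \<alpha>)
    have "?D \<alpha> = step_cost l\<^sub>0 V \<rho> h u' p' n k \<alpha> - step_cost l\<^sub>0 V \<rho> h u p n k \<alpha>"
      using elim(2) F(1)
      by (simp add: step_cost_def running_cost_def interp_eq_sum[OF F(1)]
          sum_subtractf left_diff_distrib algebra_simps)
    with c'[of \<alpha>] elim(1) show ?case by simp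
  qed
  have "c' - c = (LINT \<alpha>|\<mu>. c' - c)" by (simp add: prob_space)
  also have "\<dots> \<le> (LINT \<alpha>|\<mu>. ?D \<alpha>)"
    by (rule integral_mono_AE) (use D in auto)
  also have "\<dots> = (\<Sum>j\<in>F. (u' j (k + 1) - u j (k + 1)) * (LINT \<alpha>|\<mu>. hat \<rho> j (arrival \<rho> h n \<alpha>)))
                   + h * (p' k - p k) * (LINT \<alpha>|\<mu>. \<alpha>)"
    by (subst Bochner_Integration.integral_add) auto
  finally show ?thesis .
qed

section \<open>Reduction to finite sums\<close>

text \<open>Here \<open>c i k\<close> is the optimal value, \<open>B n i k\<close> the expected share of the mass at node \<open>n\<close> that moves
  to node \<open>i\<close>, and \<open>A n k\<close> the mean control. The set \<open>F\<^sub>0\<close> consists of the nodes with mass at some time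
  and of those reached from them in one step. The formulas are given for every finite superset
  \<open>F\<close> of \<open>F\<^sub>0\<close> so that the sums of two triplets can be taken over a common set. The last claim needs
  \<open>m n k \<noteq> 0\<close> because a node without mass may send its measure outside \<open>F\<close>.\<close>
lemma disc_operator_finite_form:
  assumes A1: "assumption_A1 l\<^sub>0 V" and \<rho>: "0 < \<rho>" and h: "0 < h"
    and w: "discrete_triplet \<rho> N (m, u, p)"
    and a: "(a\<^sub>1, a\<^sub>2, a\<^sub>3) \<in> disc_operator l\<^sub>0 V \<rho> h N Q (m, u, p)"
  obtains F\<^sub>0 c B A where "finite F\<^sub>0"
    and "\<And>i k. k \<le> N \<Longrightarrow> i \<notin> F\<^sub>0 \<Longrightarrow> m i k = 0"
    and "\<And>i k \<alpha>. k < N \<Longrightarrow> c i k \<le> step_cost l\<^sub>0 V \<rho> h u p i k \<alpha>"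
    and "\<And>i k. k < N \<Longrightarrow> a\<^sub>1 i k = c i k - u i k"
    and "\<And>F i k. finite F \<Longrightarrow> F\<^sub>0 \<subseteq> F \<Longrightarrow> k < N \<Longrightarrow>
           a\<^sub>2 i k = m i (k + 1) - (\<Sum>n\<in>F. m n k * B n i k)"
    and "\<And>i k. k < N \<Longrightarrow> i \<notin> F\<^sub>0 \<Longrightarrow> a\<^sub>2 i k = 0"
    and "\<And>F k. finite F \<Longrightarrow> F\<^sub>0 \<subseteq> F \<Longrightarrow> k < N \<Longrightarrow>
           a\<^sub>3 k = - h * (\<rho> * (\<Sum>n\<in>F. m n k * A n k) - Q k)"
    and "\<And>F n k u' p' c'. finite F \<Longrightarrow> F\<^sub>0 \<subseteq> F \<Longrightarrow> k < N \<Longrightarrow> m n k \<noteq> 0 \<Longrightarrow>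
           (\<And>\<alpha>. c' \<le> step_cost l\<^sub>0 V \<rho> h u' p' n k \<alpha>) \<Longrightarrow>
           c' - c n k \<le> (\<Sum>j\<in>F. (u' j (k + 1) - u j (k + 1)) * B n j k) + h * (p' k - p k) * A n k"
proof -
  obtain \<mu> where \<mu>: "\<mu> \<in> optimal_measures l\<^sub>0 V \<rho> h N u p"
    and a1: "\<forall>i. \<forall>k<N. \<exists>\<alpha>\<in>minimizers l\<^sub>0 V \<rho> h u p i k.
               a\<^sub>1 i k = - u i k + interp \<rho> (\<lambda>j. u j (k + 1)) (arrival \<rho> h i \<alpha>)
                      + h * running_cost l\<^sub>0 V \<rho> p i k \<alpha>"
    and a2: "\<forall>i. \<forall>k<N. a\<^sub>2 i k = m i (k + 1)
             - (\<Sum>\<^sub>\<infinity>n\<in>UNIV. m n k * (LINT \<alpha>|\<mu> n k. hat \<rho> i (arrival \<rho> h n \<alpha>)))"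
    and a3: "\<forall>k<N. a\<^sub>3 k = - h * (\<rho> * (\<Sum>\<^sub>\<infinity>i\<in>UNIV. m i k * (LINT \<alpha>|\<mu> i k. \<alpha>)) - Q k)"
    using a unfolding disc_operator_def by blast
  have prob: "prob_space (\<mu> i k)" and borel: "sets (\<mu> i k) = sets borel"
    and AE_min: "AE \<alpha> in \<mu> i k. \<alpha> \<in> minimizers l\<^sub>0 V \<rho> h u p i k" if "k < N" for i k
    using \<mu> that unfolding optimal_measures_def by auto
  have "\<exists>R. \<forall>\<alpha> \<in> minimizers l\<^sub>0 V \<rho> h u p i k. \<bar>\<alpha>\<bar> \<le> R" if "k < N" for i k
  proof -
    have "k + 1 \<le> N" using that by simp
    then obtain C where "\<forall>i j. \<bar>u i (k + 1) - u j (k + 1)\<bar> \<le> C * \<bar>grid_point \<rho> i - grid_point \<rho> j\<bar>"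
      using w unfolding discrete_triplet_def by fastforce
    then show ?thesis by (intro minimizers_bounded[OF A1 \<rho> h]) auto
  qed
  then have "\<forall>i k. \<exists>R. k < N \<longrightarrow> (\<forall>\<alpha> \<in> minimizers l\<^sub>0 V \<rho> h u p i k. \<bar>\<alpha>\<bar> \<le> R)"
    by blast
  then obtain R where R: "\<And>i k \<alpha>. k < N \<Longrightarrow> \<alpha> \<in> minimizers l\<^sub>0 V \<rho> h u p i k \<Longrightarrow> \<bar>\<alpha>\<bar> \<le> R i k"
    unfolding choice_iff by blast
  have AE_R: "AE \<alpha> in \<mu> i k. \<bar>\<alpha>\<bar> \<le> R i k" if "k < N" for i k
    using AE_min[OF that] by eventually_elim (rule R[OF that])
  have "\<forall>i k. \<exists>J. k < N \<longrightarrow> finite J \<and>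
      (AE \<alpha> in \<mu> i k. \<forall>j. j \<notin> J \<longrightarrow> hat \<rho> j (arrival \<rho> h i \<alpha>) = 0)"
    using bounded_controls_reach[OF \<rho> h prob borel AE_R] by blast
  then obtain J where J: "\<And>i k. k < N \<Longrightarrow> finite (J i k)"
    "\<And>i k. k < N \<Longrightarrow> AE \<alpha> in \<mu> i k. \<forall>j. j \<notin> J i k \<longrightarrow> hat \<rho> j (arrival \<rho> h i \<alpha>) = 0"
    unfolding choice_iff by blast
  define S where "S = {(i, k). k \<le> N \<and> m i k \<noteq> 0}"
  have S: "finite S" using w by (simp add: discrete_triplet_def S_def)
  define F\<^sub>0 where "F\<^sub>0 = fst ` S \<union> (\<Union>(i, k)\<in>{(i, k) \<in> S. k < N}. J i k)"
  have "finite {(i, k) \<in> S. k < N}"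
    by (rule finite_subset[OF _ S]) auto
  then have fin: "finite F\<^sub>0"
    unfolding F\<^sub>0_def using S J(1) by auto
  have m0: "m i k = 0" if "k \<le> N" "i \<notin> F\<^sub>0" for i k
  proof (rule ccontr)
    assume "m i k \<noteq> 0"
    then have "(i, k) \<in> S" using that(1) by (simp add: S_def)
    then have "i \<in> fst ` S" by (rule image_eqI[rotated]) simp
    then have "i \<in> F\<^sub>0" by (simp add: F\<^sub>0_def)
    with that(2) show False ..
  qed
  have J_sub: "J n k \<subseteq> F\<^sub>0" if "k < N" "m n k \<noteq> 0" for n k
  proof -
    have "(n, k) \<in> {(i, k) \<in> S. k < N}" using that by (simp add: S_def)
    then have "J n k \<subseteq> (\<Union>(i, k)\<in>{(i, k) \<in> S. k < N}. J i k)"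
      by (rule UN_upper[of "(n, k)" _ "\<lambda>(i, k). J i k", simplified prod.case])
    then show ?thesis unfolding F\<^sub>0_def by (rule le_supI2)
  qed
  have reach: "AE \<alpha> in \<mu> n k. \<forall>j. j \<notin> F \<longrightarrow> hat \<rho> j (arrival \<rho> h n \<alpha>) = 0"
    if "k < N" "m n k \<noteq> 0" "F\<^sub>0 \<subseteq> F" for n k F
    using J(2)[OF that(1), of n] by eventually_elim (use J_sub[OF that(1,2)] that(3) in auto)
  define B where "B n i k = (LINT \<alpha>|\<mu> n k. hat \<rho> i (arrival \<rho> h n \<alpha>))" for n i k
  define A where "A n k = (LINT \<alpha>|\<mu> n k. \<alpha>)" for n k
  define c where "c i k = a\<^sub>1 i k + u i k" for i k
  have c: "\<exists>\<alpha>\<in>minimizers l\<^sub>0 V \<rho> h u p i k. c i k = step_cost l\<^sub>0 V \<rho> h u p i k \<alpha>"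
    if "k < N" for i k
    using a1[rule_format, OF that, of i] by (auto simp: c_def step_cost_def)
  have c_le: "c i k \<le> step_cost l\<^sub>0 V \<rho> h u p i k \<alpha>" if k: "k < N" for i k \<alpha>
  proof -
    obtain \<beta> where "\<beta> \<in> minimizers l\<^sub>0 V \<rho> h u p i k" "c i k = step_cost l\<^sub>0 V \<rho> h u p i k \<beta>"
      using c[OF k] by blast
    then show ?thesis using step_cost_le_minimizer by simp
  qed
  have c_AE: "AE \<alpha> in \<mu> i k. step_cost l\<^sub>0 V \<rho> h u p i k \<alpha> = c i k" if k: "k < N" for i k
  proof -
    obtain \<beta> where \<beta>: "\<beta> \<in> minimizers l\<^sub>0 V \<rho> h u p i k" "c i k = step_cost l\<^sub>0 V \<rho> h u p i k \<beta>"
      using c[OF k] by blast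
    show ?thesis
      using AE_min[OF k]
    proof eventually_elim
      case (elim \<alpha>)
      then have "step_cost l\<^sub>0 V \<rho> h u p i k \<alpha> \<le> c i k"
        using step_cost_le_minimizer[OF elim] \<beta>(2) by simp
      then show ?case by (intro order_antisym c_le[OF k])
    qed
  qed
  have mB0: "m n k * B n i k = 0" if "k < N" "i \<notin> F\<^sub>0" for n i k
  proof (cases "m n k = 0")
    case False
    have "AE \<alpha> in \<mu> n k. hat \<rho> i (arrival \<rho> h n \<alpha>) = 0"
      using reach[OF that(1) False order_refl] by eventually_elim (use that(2) in auto)
    then have "B n i k = 0" unfolding B_def by (rule integral_eq_zero_AE)
    then show ?thesis by simp
  qed simp
  show ?thesis
  proof (rule that[of F\<^sub>0 c B A])
    show "a\<^sub>1 i k = c i k - u i k" for i k by (simp add: c_def)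
    show a2F: "a\<^sub>2 i k = m i (k + 1) - (\<Sum>n\<in>F. m n k * B n i k)"
      if "finite F" "F\<^sub>0 \<subseteq> F" "k < N" for F i k
    proof -
      have "(\<Sum>\<^sub>\<infinity>n\<in>UNIV. m n k * B n i k) = (\<Sum>n\<in>F. m n k * B n i k)"
        by (rule infsum_eq_sum[OF that(1)]) (use that m0[of k] in auto)
      then show ?thesis using a2[rule_format, OF that(3), of i] by (simp add: B_def)
    qed
    show "a\<^sub>2 i k = 0" if "k < N" "i \<notin> F\<^sub>0" for i k
      using a2F[OF fin order_refl that(1), of i] m0[of "k + 1" i] mB0[OF that] that by simp
    show "a\<^sub>3 k = - h * (\<rho> * (\<Sum>n\<in>F. m n k * A n k) - Q k)"
      if "finite F" "F\<^sub>0 \<subseteq> F" "k < N" for F k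
    proof -
      have "(\<Sum>\<^sub>\<infinity>n\<in>UNIV. m n k * A n k) = (\<Sum>n\<in>F. m n k * A n k)"
        by (rule infsum_eq_sum[OF that(1)]) (use that m0[of k] in auto)
      then show ?thesis using a3[rule_format, OF that(3)] by (simp add: A_def)
    qed
    show "c' - c n k \<le> (\<Sum>j\<in>F. (u' j (k + 1) - u j (k + 1)) * B n j k) + h * (p' k - p k) * A n k"
      if "finite F" "F\<^sub>0 \<subseteq> F" "k < N" "m n k \<noteq> 0"
        "\<And>\<alpha>. c' \<le> step_cost l\<^sub>0 V \<rho> h u' p' n k \<alpha>" for F n k u' p' c'
      unfolding A_def B_def
      by (rule optimal_value_supergradient[OF \<rho> prob borel c_AE AE_R]) (use that reach in auto)
  qed (use fin m0 c_le in auto)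
qed

text \<open>One time level of the pairing, as pure algebra: \<open>M\<close> and \<open>v\<close> stand for the mass and the value at
  the next time, \<open>q\<close> for the datum \<open>Q k\<close>, which cancels. The first summand on the right is
  the increment that telescopes; the other two are the supergradient gaps, with the mass equation
  transposed by exchanging the order of summation.\<close>
lemma monotonicity_identity:
  fixes m m' u u' v v' c c' A A' :: "'a \<Rightarrow> real" and B B' :: "'a \<Rightarrow> 'a \<Rightarrow> real"
  shows "\<rho> * (\<Sum>i\<in>F. ((c' i - u' i) - (c i - u i)) * (m' i - m i)
              + ((M' i - (\<Sum>n\<in>F. m' n * B' n i)) - (M i - (\<Sum>n\<in>F. m n * B n i))) * (v' i - v i))
         + (- h * (\<rho> * (\<Sum>n\<in>F. m' n * A' n) - q) - - h * (\<rho> * (\<Sum>n\<in>F. m n * A n) - q)) * (p' - p)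
       = \<rho> * ((\<Sum>i\<in>F. (M' i - M i) * (v' i - v i)) - (\<Sum>i\<in>F. (m' i - m i) * (u' i - u i)))
         + \<rho> * (\<Sum>n\<in>F. m' n * ((\<Sum>j\<in>F. (v j - v' j) * B' n j) + h * (p - p') * A' n - (c n - c' n)))
         + \<rho> * (\<Sum>n\<in>F. m n * ((\<Sum>j\<in>F. (v' j - v j) * B n j) + h * (p' - p) * A n - (c' n - c n)))"
proof -
  have swap: "(\<Sum>i\<in>F. (\<Sum>n\<in>F. f n * G n i) * d i) = (\<Sum>n\<in>F. f n * (\<Sum>j\<in>F. d j * G n j))"
    for f d :: "'a \<Rightarrow> real" and G
    by (simp add: sum_distrib_left sum_distrib_right ac_simps) (rule sum.swap)
  have neg: "(\<Sum>j\<in>F. (v j - v' j) * B' n j) = - (\<Sum>j\<in>F. (v' j - v j) * B' n j)" for n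
    unfolding sum_negf[symmetric] by (rule sum.cong) (auto simp: algebra_simps)
  have split: "(\<Sum>i\<in>F. ((c' i - u' i) - (c i - u i)) * (m' i - m i)
              + ((M' i - (\<Sum>n\<in>F. m' n * B' n i)) - (M i - (\<Sum>n\<in>F. m n * B n i))) * (v' i - v i))
      = (\<Sum>i\<in>F. (M' i - M i) * (v' i - v i)) - (\<Sum>i\<in>F. (m' i - m i) * (u' i - u i))
        + (\<Sum>i\<in>F. m' i * (c' i - c i)) - (\<Sum>i\<in>F. m i * (c' i - c i))
        - (\<Sum>i\<in>F. (\<Sum>n\<in>F. m' n * B' n i) * (v' i - v i))
        + (\<Sum>i\<in>F. (\<Sum>n\<in>F. m n * B n i) * (v' i - v i))"
    by (simp only: sum.distrib[symmetric] sum_subtractf[symmetric])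
       (rule sum.cong[OF refl], simp only: algebra_simps)
  have part': "(\<Sum>n\<in>F. m' n * ((\<Sum>j\<in>F. (v j - v' j) * B' n j) + h * (p - p') * A' n - (c n - c' n)))
     = h * (p - p') * (\<Sum>n\<in>F. m' n * A' n) + (\<Sum>i\<in>F. m' i * (c' i - c i))
       - (\<Sum>n\<in>F. m' n * (\<Sum>j\<in>F. (v' j - v j) * B' n j))"
    unfolding neg sum_distrib_left[of "h * (p - p')"]
    by (simp only: sum.distrib[symmetric] sum_subtractf[symmetric])
       (rule sum.cong[OF refl], simp only: algebra_simps)
  have part: "(\<Sum>n\<in>F. m n * ((\<Sum>j\<in>F. (v' j - v j) * B n j) + h * (p' - p) * A n - (c' n - c n)))
     = (\<Sum>n\<in>F. m n * (\<Sum>j\<in>F. (v' j - v j) * B n j)) + h * (p' - p) * (\<Sum>n\<in>F. m n * A n)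
       - (\<Sum>i\<in>F. m i * (c' i - c i))"
    unfolding sum_distrib_left[of "h * (p' - p)"]
    by (simp only: sum.distrib[symmetric] sum_subtractf[symmetric])
       (rule sum.cong[OF refl], simp only: algebra_simps)
  show ?thesis
    unfolding split swap part part' by (simp add: algebra_simps)
qed

theorem lemma7p2:
  fixes l\<^sub>0 V :: "real \<Rightarrow> real" and \<rho> h T :: real and N :: nat
    and Q :: "nat \<Rightarrow> real" and mbar ubar :: "int \<Rightarrow> real"
    and m u m' u' :: "int \<Rightarrow> nat \<Rightarrow> real" and p p' :: "nat \<Rightarrow> real"
    and a a' :: triplet
  assumes "assumption_A1 l\<^sub>0 V"
    and "\<rho> > 0" and "h > 0" and "real N * h = T"
    and "discrete_triplet \<rho> N (m, u, p)" and "discrete_triplet \<rho> N (m', u', p')"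
    and "\<And>i k. k \<le> N \<Longrightarrow> m i k \<ge> 0" and "\<And>i k. k \<le> N \<Longrightarrow> m' i k \<ge> 0"
    and "\<And>i. m i 0 = mbar i" and "\<And>i. m' i 0 = mbar i"
    and "\<And>i. u i N = ubar i" and "\<And>i. u' i N = ubar i"
    and "a \<in> disc_operator l\<^sub>0 V \<rho> h N Q (m, u, p)"
    and "a' \<in> disc_operator l\<^sub>0 V \<rho> h N Q (m', u', p')"
  shows "pairing \<rho> h N (a' - a) ((m', u', p') - (m, u, p)) \<ge> 0"
proof -
  note A1 = assms(1) and \<rho> = assms(2) and h = assms(3) and w = assms(5) and w' = assms(6)
    and m_nonneg = assms(7) and m'_nonneg = assms(8) and initial = assms(9,10)
    and final = assms(11,12)
  obtain a\<^sub>1 a\<^sub>2 a\<^sub>3 a\<^sub>1' a\<^sub>2' a\<^sub>3' where a_eq: "a = (a\<^sub>1, a\<^sub>2, a\<^sub>3)" "a' = (a\<^sub>1', a\<^sub>2', a\<^sub>3')"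
    by (metis prod.exhaust)
  obtain F c B A where F: "finite F" "\<And>i k. k \<le> N \<Longrightarrow> i \<notin> F \<Longrightarrow> m i k = 0"
    and c: "\<And>i k \<alpha>. k < N \<Longrightarrow> c i k \<le> step_cost l\<^sub>0 V \<rho> h u p i k \<alpha>"
    and a1: "\<And>i k. k < N \<Longrightarrow> a\<^sub>1 i k = c i k - u i k"
    and a2: "\<And>G i k. finite G \<Longrightarrow> F \<subseteq> G \<Longrightarrow> k < N \<Longrightarrow>
           a\<^sub>2 i k = m i (k + 1) - (\<Sum>n\<in>G. m n k * B n i k)"
    and a2_0: "\<And>i k. k < N \<Longrightarrow> i \<notin> F \<Longrightarrow> a\<^sub>2 i k = 0"
    and a3: "\<And>G k. finite G \<Longrightarrow> F \<subseteq> G \<Longrightarrow> k < N \<Longrightarrow>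
           a\<^sub>3 k = - h * (\<rho> * (\<Sum>n\<in>G. m n k * A n k) - Q k)"
    and concave: "\<And>G n k u' p' c'. finite G \<Longrightarrow> F \<subseteq> G \<Longrightarrow> k < N \<Longrightarrow> m n k \<noteq> 0 \<Longrightarrow>
           (\<And>\<alpha>. c' \<le> step_cost l\<^sub>0 V \<rho> h u' p' n k \<alpha>) \<Longrightarrow>
           c' - c n k \<le> (\<Sum>j\<in>G. (u' j (k + 1) - u j (k + 1)) * B n j k) + h * (p' k - p k) * A n k"
    using disc_operator_finite_form[OF A1 \<rho> h w assms(13)[unfolded a_eq]] by blast
  obtain F' c' B' A' where F': "finite F'" "\<And>i k. k \<le> N \<Longrightarrow> i \<notin> F' \<Longrightarrow> m' i k = 0"
    and c': "\<And>i k \<alpha>. k < N \<Longrightarrow> c' i k \<le> step_cost l\<^sub>0 V \<rho> h u' p' i k \<alpha>"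
    and a1': "\<And>i k. k < N \<Longrightarrow> a\<^sub>1' i k = c' i k - u' i k"
    and a2': "\<And>G i k. finite G \<Longrightarrow> F' \<subseteq> G \<Longrightarrow> k < N \<Longrightarrow>
           a\<^sub>2' i k = m' i (k + 1) - (\<Sum>n\<in>G. m' n k * B' n i k)"
    and a2'_0: "\<And>i k. k < N \<Longrightarrow> i \<notin> F' \<Longrightarrow> a\<^sub>2' i k = 0"
    and a3': "\<And>G k. finite G \<Longrightarrow> F' \<subseteq> G \<Longrightarrow> k < N \<Longrightarrow>
           a\<^sub>3' k = - h * (\<rho> * (\<Sum>n\<in>G. m' n k * A' n k) - Q k)"
    and concave': "\<And>G n k u p c. finite G \<Longrightarrow> F' \<subseteq> G \<Longrightarrow> k < N \<Longrightarrow> m' n k \<noteq> 0 \<Longrightarrow>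
           (\<And>\<alpha>. c \<le> step_cost l\<^sub>0 V \<rho> h u p n k \<alpha>) \<Longrightarrow>
           c - c' n k \<le> (\<Sum>j\<in>G. (u j (k + 1) - u' j (k + 1)) * B' n j k) + h * (p k - p' k) * A' n k"
    using disc_operator_finite_form[OF A1 \<rho> h w' assms(14)[unfolded a_eq]] by blast
  define G where "G = F \<union> F'"
  have G: "finite G" "F \<subseteq> G" "F' \<subseteq> G" using F(1) F'(1) by (auto simp: G_def)
  \<comment> \<open>The duality bracket of the two solutions, whose increments are the terms that telescope.\<close>
  define E where "E k = (\<Sum>i\<in>G. (m' i k - m i k) * (u' i k - u i k))" for k
  have level: "\<rho> * (E (Suc k) - E k) \<le>
      \<rho> * (\<Sum>\<^sub>\<infinity>i\<in>UNIV. (a\<^sub>1' i k - a\<^sub>1 i k) * (m' i k - m i k)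
                        + (a\<^sub>2' i k - a\<^sub>2 i k) * (u' i (k + 1) - u i (k + 1)))
      + (a\<^sub>3' k - a\<^sub>3 k) * (p' k - p k)" (is "_ \<le> ?P") if k: "k < N" for k
  proof -
    have sum_eq: "(\<Sum>\<^sub>\<infinity>i\<in>UNIV. (a\<^sub>1' i k - a\<^sub>1 i k) * (m' i k - m i k)
                        + (a\<^sub>2' i k - a\<^sub>2 i k) * (u' i (k + 1) - u i (k + 1)))
       = (\<Sum>i\<in>G. (a\<^sub>1' i k - a\<^sub>1 i k) * (m' i k - m i k)
                        + (a\<^sub>2' i k - a\<^sub>2 i k) * (u' i (k + 1) - u i (k + 1)))"
      by (rule infsum_eq_sum[OF G(1)]) (use k F(2) F'(2) a2_0 a2'_0 in \<open>auto simp: G_def\<close>)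
    have gap: "0 \<le> m n k * ((\<Sum>j\<in>G. (u' j (k + 1) - u j (k + 1)) * B n j k)
                  + h * (p' k - p k) * A n k - (c' n k - c n k))" for n
    proof (cases "m n k = 0")
      case False
      then show ?thesis
        using concave[OF G(1,2) k False c'[OF k]] m_nonneg[of k n] k by (intro mult_nonneg_nonneg) auto
    qed simp
    have gap': "0 \<le> m' n k * ((\<Sum>j\<in>G. (u j (k + 1) - u' j (k + 1)) * B' n j k)
                  + h * (p k - p' k) * A' n k - (c n k - c' n k))" for n
    proof (cases "m' n k = 0")
      case False
      then show ?thesis
        using concave'[OF G(1,3) k False c[OF k]] m'_nonneg[of k n] k by (intro mult_nonneg_nonneg) auto
    qed simp
    have "?P = \<rho> * (E (Suc k) - E k)
        + \<rho> * (\<Sum>n\<in>G. m' n k * ((\<Sum>j\<in>G. (u j (k + 1) - u' j (k + 1)) * B' n j k)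
                  + h * (p k - p' k) * A' n k - (c n k - c' n k)))
        + \<rho> * (\<Sum>n\<in>G. m n k * ((\<Sum>j\<in>G. (u' j (k + 1) - u j (k + 1)) * B n j k)
                  + h * (p' k - p k) * A n k - (c' n k - c n k)))"
      unfolding sum_eq
      unfolding a1[OF k] a1'[OF k] a2[OF G(1,2) k] a2'[OF G(1,3) k]
        a3[OF G(1,2) k] a3'[OF G(1,3) k] monotonicity_identity E_def by simp
    also have "\<dots> \<ge> \<rho> * (E (Suc k) - E k)"
      using \<rho> gap gap' by (simp add: sum_nonneg)
    finally show ?thesis .
  qed
  have E_0: "E 0 = 0" and E_N: "E N = 0" using initial final by (simp_all add: E_def)
  have "0 = (\<Sum>k<N. \<rho> * (E (Suc k) - E k))"
    using E_0 E_N by (simp add: sum_distrib_left[symmetric] sum_lessThan_telescope)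
  also have "\<dots> \<le> (\<Sum>k<N. \<rho> * (\<Sum>\<^sub>\<infinity>i\<in>UNIV. (a\<^sub>1' i k - a\<^sub>1 i k) * (m' i k - m i k)
                        + (a\<^sub>2' i k - a\<^sub>2 i k) * (u' i (k + 1) - u i (k + 1)))
      + (a\<^sub>3' k - a\<^sub>3 k) * (p' k - p k))"
    by (rule sum_mono) (use level in auto)
  finally show ?thesis
    using h by (simp add: pairing_def a_eq fun_diff_def)
qed

end
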